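(* Let $Y$ be a random vector in $\mathbb{R}^d$, $A\in\mathbb{R}^{d\times d}$ invertible, and $\varepsilon=AY$ with $\mathbb{E}\varepsilon=0$ and $\mathrm{var}(\varepsilon)=I_d$; moments of $\varepsilon$ of the orders used below are assumed finite. (1) If $\varepsilon=\tau\odot\eta$ with $\tau=\phi(KZ)$, where $K\in\mathbb{R}^{d\times m}$ is a fixed matrix, $\eta\in\mathbb{R}^d$ and $Z\in\mathbb{R}^m$ are independent random vectors, each with independent components, and $\phi:\mathbb{R}\to\mathbb{R}_{>0}$ is applied coordinatewise, then $h_4(\varepsilon)$ is reflectionally invariant. (2) If $\varepsilon=\tau\odot U$, where $U$ is uniformly distributed on the unit sphere of $\mathbb{R}^d$ and $\tau$ is a random vector in $\mathbb{R}^d$ independent of $U$, then $h_r(\varepsilon)$ is reflectionally invariant for every even $r\ge4$. (3) If $\mathbb{E}(\varepsilon_i\mid\varepsilon_{-i})=0$ for $i=1,\dots,d$, then $h_4(\varepsilon)$ is reflectionally invariant. If additionally, in one of these cases (with $r=4$ in (1) and (3), and $r\geq 4$ even in (2)), the tensor $T=h_r(\varepsilon)$ satisfies, with $l=(r-2)/2$, $$\sum_{i_1,\dots,i_l=1}^d T_{i_1i_1\cdots i_li_ljj}\neq\sum_{i_1,\dots,i_l=1}^d T_{i_1i_1\cdots i_li_lkk}\qquad\text{for all }j\neq k,$$ then $A$ is identifiable up to permuting and swapping signs of its rows, i.e. $$\{B\in\mathbb{R}^{d\times d}\text{ invertible}:\mathrm{var}(BY)=I_d,\ h_r(BY)\text{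 is reflectionally invariant}\}=\{QA:Q\in\mathrm{SP}(d)\}.$$
   Context: For a random vector $X$ in $\mathbb{R}^d$ with finite $r$-th moments, $h_r(X)$ denotes (one fixed choice throughout of) either the moment tensor $\mu_r(X)_{i_1\cdots i_r}=\mathbb{E}[X_{i_1}\cdots X_{i_r}]$ or the cumulant tensor $\kappa_r(X)_{i_1\cdots i_r}=\mathrm{cum}(X_{i_1},\dots,X_{i_r})=\sum_{\pi}(-1)^{|\pi|-1}(|\pi|-1)!\prod_{B\in\pi}\mathbb{E}\prod_{k\in B}X_{i_k}$ (sum over set partitions $\pi$ of $\{1,\dots,r\}$). The result holds for either choice. A symmetric order-$r$ tensor $T$ is reflectionally invariant if $T_{i_1\cdots i_r}=0$ unless each index value appears in $(i_1,\dots,i_r)$ an even number of times. $\odot$ is the coordinatewise (Hadamard) product; $\varepsilon_{-i}$ is $\varepsilon$ with its $i$-th coordinate removed. $\mathrm{SP}(d)$ is the set of $d\times d$ signed permutation matrices, i.e. matrices $DP$ with $D$ diagonal with $\pm1$ diagonal entries and $P$ a permutation matrix. *)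

theory Defs
  imports "HOL-Probability.Probability" "HOL-Library.Disjoint_Sets"
begin

(* An order-r tensor over an index type 'd is a function on index lists; only its values
   on lists [i_1, ..., i_r] of length r matter. The order r is an explicit argument. *)

type_synonym 'd tensor = "'d list \<Rightarrow> real"

definition finite_moments :: "'a measure \<Rightarrow> nat \<Rightarrow> ('a \<Rightarrow> real^'d) \<Rightarrow> bool" where
  "finite_moments M r X \<longleftrightarrow> (\<forall>i. integrable M (\<lambda>\<omega>. \<bar>X \<omega> $ i\<bar> ^ r))"

definition moment_tensor :: "'a measure \<Rightarrow> nat \<Rightarrow> ('a \<Rightarrow> real^'d) \<Rightarrow> 'd tensor" where
  "moment_tensor M r X is = (\<integral>\<omega>. (\<Prod>k<r. X \<omega> $ (is ! k)) \<partial>M)"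

definition cumulant_tensor :: "'a measure \<Rightarrow> nat \<Rightarrow> ('a \<Rightarrow> real^'d) \<Rightarrow> 'd tensor" where
  "cumulant_tensor M r X is =
     (\<Sum>\<pi> | partition_on {..<r} \<pi>.
        (-1) ^ (card \<pi> - 1) * fact (card \<pi> - 1) *
        (\<Prod>B\<in>\<pi>. \<integral>\<omega>. (\<Prod>k\<in>B. X \<omega> $ (is ! k)) \<partial>M))"

(* Applied only to moment and cumulant tensors, which are symmetric by construction. *)

definition reflectionally_invariant :: "nat \<Rightarrow> 'd tensor \<Rightarrow> bool" where
  "reflectionally_invariant r T \<longleftrightarrow>
     (\<forall>is. length is = r \<longrightarrow> \<not> (\<forall>i. even (count_list is i)) \<longrightarrow> T is = 0)"

(* The sum over i_1, ..., i_l of T with indices i_1 i_1 ... i_l i_l j j. *)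

definition diagonal_contraction :: "nat \<Rightarrow> 'd::finite tensor \<Rightarrow> 'd \<Rightarrow> real" where
  "diagonal_contraction l T j =
     (\<Sum>is | length is = l. T (concat (map (\<lambda>i. [i, i]) is) @ [j, j]))"

definition covariance_matrix :: "'a measure \<Rightarrow> ('a \<Rightarrow> real^'d) \<Rightarrow> real^'d^'d" where
  "covariance_matrix M X =
     (\<chi> i j. \<integral>\<omega>. (X \<omega> $ i - (\<integral>\<omega>. X \<omega> $ i \<partial>M)) * (X \<omega> $ j - (\<integral>\<omega>. X \<omega> $ j \<partial>M)) \<partial>M)"

definition sign_matrices :: "(real^'d^'d) set" where
  "sign_matrices =
     {D. \<exists>s. (\<forall>i. s i = 1 \<or> s i = -1) \<and> D = (\<chi> i j. if i = j then s i else 0)}"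

definition permutation_matrices :: "(real^'d^'d) set" where
  "permutation_matrices =
     {P. \<exists>p. bij p \<and> P = (\<chi> i j. if j = p i then 1 else 0)}"

definition signed_permutation_matrices :: "(real^'d^'d) set" where
  "signed_permutation_matrices =
     {D ** P | D P. D \<in> sign_matrices \<and> P \<in> permutation_matrices}"

(* Normalised surface measure on the unit sphere, as the radial projection
   x / norm x of the uniform distribution on the unit ball: a Borel set S of directions gets
   the fraction of the volume of the ball that lies in the cone over S. *)

definition uniform_sphere :: "(real^'d) measure" where
  "uniform_sphere = distr (uniform_measure lborel (ball 0 1)) borel sgn"

(* The library's indep_var requires both variables to have the same type; this is its
   definition for vectors of possibly different dimensions, independence of the generated
   sigma-algebras. *)

definition independent_vectors ::
    "'a measure \<Rightarrow> ('a \<Rightarrow> real^'m) \<Rightarrow> ('a \<Rightarrow> real^'n) \<Rightarrow> bool" where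
  "independent_vectors M X Y \<longleftrightarrow>
     X \<in> borel_measurable M \<and> Y \<in> borel_measurable M \<and>
     prob_space.indep_set M {X -` S \<inter> space M | S. S \<in> sets borel}
                            {Y -` S \<inter> space M | S. S \<in> sets borel}"

(* Multiplication on real^'d is coordinatewise, i.e. the Hadamard product. *)

definition independent_components_model ::
    "'a measure \<Rightarrow> (real \<Rightarrow> real) \<Rightarrow> real^'m^'d \<Rightarrow> ('a \<Rightarrow> real^'m) \<Rightarrow> ('a \<Rightarrow> real^'d) \<Rightarrow>
     ('a \<Rightarrow> real^'d) \<Rightarrow> bool" where
  "independent_components_model M \<phi> K Z \<eta> \<epsilon> \<longleftrightarrow>
     \<phi> \<in> borel_measurable borel \<and> (\<forall>x. \<phi> x > 0) \<and>
     independent_vectors M \<eta> Z \<and>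
     prob_space.indep_vars M (\<lambda>_. borel) (\<lambda>i \<omega>. \<eta> \<omega> $ i) UNIV \<and>
     prob_space.indep_vars M (\<lambda>_. borel) (\<lambda>i \<omega>. Z \<omega> $ i) UNIV \<and>
     (AE \<omega> in M. \<epsilon> \<omega> = (\<chi> i. \<phi> ((K *v Z \<omega>) $ i)) * \<eta> \<omega>)"

definition spherical_model ::
    "'a measure \<Rightarrow> ('a \<Rightarrow> real^'d) \<Rightarrow> ('a \<Rightarrow> real^'d) \<Rightarrow> ('a \<Rightarrow> real^'d) \<Rightarrow> bool" where
  "spherical_model M \<tau> U \<epsilon> \<longleftrightarrow>
     distr M borel U = uniform_sphere \<and>
     independent_vectors M \<tau> U \<and>
     (AE \<omega> in M. \<epsilon> \<omega> = \<tau> \<omega> * U \<omega>)"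

definition sigma_algebra_without :: "'a measure \<Rightarrow> ('a \<Rightarrow> real^'d) \<Rightarrow> 'd \<Rightarrow> 'a measure" where
  "sigma_algebra_without M X i =
     vimage_algebra (space M) (\<lambda>\<omega>. \<lambda>j\<in>-{i}. X \<omega> $ j) (\<Pi>\<^sub>M j\<in>-{i}. borel)"

definition mean_independent_components :: "'a measure \<Rightarrow> ('a \<Rightarrow> real^'d) \<Rightarrow> bool" where
  "mean_independent_components M \<epsilon> \<longleftrightarrow>
     (\<forall>i. AE \<omega> in M. real_cond_exp M (sigma_algebra_without M \<epsilon> i) (\<lambda>\<omega>. \<epsilon> \<omega> $ i) \<omega> = 0)"

end

theory Submission
  imports Defs
begin

text \<open>In each model a joint moment of the components vanishes when some index occurs an odd number of
  times (exactly once, in models (1) and (3)). A cumulant is a sum over set partitions, and a tensor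
  index that occurs an odd number of times does so in some block, so cumulants vanish with moments.

  For identifiability, moments and cumulants of \<open>v\<^sub>1 \<bullet> \<epsilon>, \<dots>, v\<^sub>r \<bullet> \<epsilon>\<close> are multilinear in
  \<open>v\<^sub>1, \<dots>, v\<^sub>r\<close>, so the contraction of all but two slots over an orthonormal
  basis does not depend on the basis. Reflectional invariance of
  \<open>h\<^sub>r(\<epsilon>)\<close> and \<open>h\<^sub>r(Q\<epsilon>)\<close>, with \<open>Q\<close> orthogonal, says that the resulting bilinear form is
  diagonal both in the standard basis and in the rows of \<open>Q\<close>. Since its diagonal entries in the
  standard basis are distinct, the rows of \<open>Q\<close> are signed standard basis vectors.\<close>

subsection \<open>Vanishing joint moments\<close>

lemma (in prob_space) indep_var_sym:
  assumes "indep_var S X T Y"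
  shows "indep_var T Y S X"
proof -
  have "indep_set B A" if "indep_set A B" for A B
    using that unfolding indep_sets2_eq by (metis Int_commute mult.commute)
  with assms show ?thesis unfolding indep_var_eq by blast
qed

text \<open>In \<open>[0, \<infinity>]\<close>, independence gives E|XY| = E|X| E|Y|. An infinite
  first factor keeps the product finite only when E|Y| = 0.\<close>

lemma (in prob_space) indep_var_integrable_factor:
  fixes X Y :: "'a \<Rightarrow> real"
  assumes ind: "indep_var borel X borel Y"
    and int: "integrable M (\<lambda>\<omega>. X \<omega> * Y \<omega>)" and not: "\<not> integrable M X"
  shows "AE \<omega> in M. Y \<omega> = 0"
proof -
  have [measurable]: "random_variable borel X" "random_variable borel Y"
    using indep_var_rv1[OF ind] indep_var_rv2[OF ind] by auto
  have "indep_var borel (ennreal \<circ> abs \<circ> X) borel (ennreal \<circ> abs \<circ> Y)"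
    by (rule indep_var_compose[OF ind]) (auto simp: comp_def)
  \<comment> \<open>The product rule for nonnegative integrals concerns families, so the pair
    becomes a family over \<open>bool\<close>.\<close>
  then have "indep_vars (\<lambda>_. borel) (case_bool (ennreal \<circ> abs \<circ> X) (ennreal \<circ> abs \<circ> Y)) UNIV"
    unfolding indep_var_def by (rule indep_vars_cong[THEN iffD1, rotated 3]) (auto split: bool.split)
  from indep_vars_nn_integral[OF _ this]
  have prod: "(\<integral>\<^sup>+\<omega>. ennreal \<bar>X \<omega>\<bar> * ennreal \<bar>Y \<omega>\<bar> \<partial>M)
      = (\<integral>\<^sup>+\<omega>. ennreal \<bar>X \<omega>\<bar> \<partial>M) * (\<integral>\<^sup>+\<omega>. ennreal \<bar>Y \<omega>\<bar> \<partial>M)"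
    by (simp add: UNIV_bool mult.commute comp_def)
  have fin: "(\<integral>\<^sup>+\<omega>. ennreal \<bar>X \<omega>\<bar> * ennreal \<bar>Y \<omega>\<bar> \<partial>M) < \<infinity>"
    using int by (simp add: integrable_iff_bounded ennreal_mult'[symmetric] abs_mult)
  from not have "(\<integral>\<^sup>+\<omega>. ennreal \<bar>X \<omega>\<bar> \<partial>M) = \<infinity>"
    by (auto simp: integrable_iff_bounded less_top[symmetric])
  with prod fin have "(\<integral>\<^sup>+\<omega>. ennreal \<bar>Y \<omega>\<bar> \<partial>M) = 0"
    by (auto simp: ennreal_top_mult split: if_splits)
  then show ?thesis
    by (subst (asm) nn_integral_0_iff_AE) auto
qed

text \<open>With Bochner's junk value 0 the identity needs no integrability: if a factor is not integrable, then the right-hand side is zero,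
  and so is the left-hand side, because the product can then be integrable only if it vanishes
  almost everywhere.\<close>

lemma (in prob_space) indep_var_expectation_mult:
  fixes X Y :: "'a \<Rightarrow> real"
  assumes ind: "indep_var borel X borel Y"
  shows "expectation (\<lambda>\<omega>. X \<omega> * Y \<omega>) = expectation X * expectation Y"
proof (cases "integrable M X \<and> integrable M Y")
  case True
  then show ?thesis using indep_var_lebesgue_integral[OF ind] by simp
next
  case False
  have "expectation (\<lambda>\<omega>. X \<omega> * Y \<omega>) = 0"
  proof (cases "integrable M (\<lambda>\<omega>. X \<omega> * Y \<omega>)")
    case int: True
    have "(AE \<omega> in M. X \<omega> = 0) \<or> (AE \<omega> in M. Y \<omega> = 0)"
      using False indep_var_integrable_factor[OF ind int]
        indep_var_integrable_factor[OF indep_var_sym[OF ind]] int by (auto simp: mult.commute)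
    then have "AE \<omega> in M. X \<omega> * Y \<omega> = 0"
      by auto
    then show ?thesis
      by (rule integral_eq_zero_AE)
  qed (rule not_integrable_integral_eq)
  moreover have "expectation X * expectation Y = 0"
    using False by (auto simp: not_integrable_integral_eq)
  ultimately show ?thesis by simp
qed

text \<open>Preimages under \<open>f (V \<omega>)\<close> are among the preimages under
  \<open>V\<close>, so independence is inherited. They form an intersection-stable system, and hence
  the generated sigma-algebras are independent too.\<close>

lemma (in prob_space) independent_vectors_indep_var:
  fixes V :: "'a \<Rightarrow> real^'m" and W :: "'a \<Rightarrow> real^'n"
  assumes "independent_vectors M V W"
    and [measurable]: "f \<in> borel_measurable borel" "g \<in> borel_measurable borel"
  shows "indep_var borel (\<lambda>\<omega>. f (V \<omega>) :: real) borel (\<lambda>\<omega>. g (W \<omega>) :: real)"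
proof -
  have [measurable]: "V \<in> borel_measurable M" "W \<in> borel_measurable M"
    and ind: "indep_set {V -` S \<inter> space M | S. S \<in> sets borel} {W -` S \<inter> space M | S. S \<in> sets borel}"
    using assms(1) by (auto simp: independent_vectors_def)
  have stable: "Int_stable {X -` S \<inter> space M | S. S \<in> sets borel}" for X :: "'a \<Rightarrow> real"
  proof (rule Int_stableI, clarify)
    fix S T :: "real set" assume "S \<in> sets borel" "T \<in> sets borel"
    then show "\<exists>R. X -` S \<inter> space M \<inter> (X -` T \<inter> space M) = X -` R \<inter> space M \<and> R \<in> sets borel"
      by (intro exI[of _ "S \<inter> T"]) auto
  qed
  have sub: "{(\<lambda>\<omega>. q (X \<omega>)) -` S \<inter> space M | S. S \<in> sets borel} \<subseteq> {X -` S \<inter> space M | S. S \<in> sets borel}"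
    if q: "q \<in> borel_measurable borel" for q :: "real^'k \<Rightarrow> real" and X :: "'a \<Rightarrow> real^'k"
  proof clarify
    fix S :: "real set" assume "S \<in> sets borel"
    then have "q -` S \<in> sets borel" using q measurable_sets[OF q, of S] by simp
    then show "\<exists>S'. (\<lambda>\<omega>. q (X \<omega>)) -` S \<inter> space M = X -` S' \<inter> space M \<and> S' \<in> sets borel"
      by (intro exI[of _ "q -` S"]) auto
  qed
  have "indep_set {(\<lambda>\<omega>. f (V \<omega>)) -` S \<inter> space M | S. S \<in> sets borel}
                  {(\<lambda>\<omega>. g (W \<omega>)) -` S \<inter> space M | S. S \<in> sets borel}"
    using ind sub[OF assms(2), of V] sub[OF assms(3), of W] unfolding indep_sets2_eq
    by (meson subset_iff)
  then have "indep_set (sigma_sets (space M) {(\<lambda>\<omega>. f (V \<omega>)) -` S \<inter> space M | S. S \<in> sets borel})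
                  (sigma_sets (space M) {(\<lambda>\<omega>. g (W \<omega>)) -` S \<inter> space M | S. S \<in> sets borel})"
    by (rule indep_set_sigma_sets[OF _ stable stable])
  then show ?thesis
    by (simp add: indep_var_eq)
qed

section \<open>Joint moments in the three models\<close>

lemma borel_measurable_vec_nth [measurable]:
  "(\<lambda>x :: real^'n. x $ i) \<in> borel_measurable borel"
  by (intro borel_measurable_continuous_onI continuous_intros)

text \<open>The moment factors into a part in \<open>\<eta>\<close> and a part in \<open>Z\<close>.
  As the index \<open>f k\<close> occurs only once in \<open>B\<close>, the \<open>\<eta>\<close>
  part has the factor E \<open>\<eta> $ f k\<close>, and this is 0 because
  \<open>\<epsilon> $ f k\<close> is centred and the scale is positive.\<close>

lemma (in prob_space) independent_components_joint_moment_0: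
  fixes \<epsilon> \<eta> :: "'a \<Rightarrow> real^'d" and Z :: "'a \<Rightarrow> real^'m"
  assumes model: "independent_components_model M \<phi> K Z \<eta> \<epsilon>"
    and [measurable]: "\<epsilon> \<in> borel_measurable M"
    and int: "integrable M (\<lambda>\<omega>. \<epsilon> \<omega> $ f k)" and mean: "expectation (\<lambda>\<omega>. \<epsilon> \<omega> $ f k) = 0"
    and B: "finite B" "k \<in> B" and once: "\<And>i. i \<in> B \<Longrightarrow> f i = f k \<Longrightarrow> i = k"
  shows "expectation (\<lambda>\<omega>. \<Prod>i\<in>B. \<epsilon> \<omega> $ f i) = 0"
proof -
  define \<tau> where "\<tau> i z = \<phi> ((K *v z) $ i)" for i z
  have [measurable]: "\<phi> \<in> borel_measurable borel" and pos: "\<tau> i z > 0"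
    and ind: "independent_vectors M \<eta> Z"
    and ind\<eta>: "indep_vars (\<lambda>_. borel) (\<lambda>i \<omega>. \<eta> \<omega> $ i) UNIV"
    and eq: "AE \<omega> in M. \<epsilon> \<omega> = (\<chi> i. \<tau> i (Z \<omega>)) * \<eta> \<omega>" for i z
    using model by (auto simp: independent_components_model_def \<tau>_def)
  have [measurable]: "\<eta> \<in> borel_measurable M" "Z \<in> borel_measurable M"
    using ind by (auto simp: independent_vectors_def)
  have [measurable]: "(\<lambda>z. (K *v z) $ i) \<in> borel_measurable borel" for i
    by (intro borel_measurable_continuous_onI continuous_intros)
  have [measurable]: "\<tau> i \<in> borel_measurable borel" for i
    unfolding \<tau>_def by measurable
  have prod_eq: "AE \<omega> in M. (\<Prod>i\<in>C. \<epsilon> \<omega> $ f i) = (\<Prod>i\<in>C. \<tau> (f i) (Z \<omega>)) * (\<Prod>i\<in>C. \<eta> \<omega> $ f i)" for C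
    using eq by eventually_elim (simp add: prod.distrib)
  have indep: "indep_var borel (\<lambda>\<omega>. \<Prod>i\<in>C. \<eta> \<omega> $ f i) borel (\<lambda>\<omega>. \<Prod>i\<in>C. \<tau> (f i) (Z \<omega>))" for C
    by (rule independent_vectors_indep_var[OF ind]) measurable
  have split: "expectation (\<lambda>\<omega>. \<Prod>i\<in>C. \<epsilon> \<omega> $ f i)
      = expectation (\<lambda>\<omega>. \<Prod>i\<in>C. \<eta> \<omega> $ f i) * expectation (\<lambda>\<omega>. \<Prod>i\<in>C. \<tau> (f i) (Z \<omega>))" for C
    unfolding indep_var_expectation_mult[OF indep, symmetric]
    by (rule integral_cong_AE) (use prod_eq[of C] in \<open>auto simp: mult.commute\<close>)
  \<comment> \<open>If the scale is integrable, its expectation is nonzero and cancels from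
    \<open>split\<close>. Otherwise its Bochner integral is 0 by default and \<open>split\<close>
    says nothing; but then integrability of \<open>\<epsilon> $ f k\<close> makes
    \<open>\<eta> $ f k\<close> vanish almost everywhere.\<close>
  have "expectation (\<lambda>\<omega>. \<eta> \<omega> $ f k) = 0"
  proof (cases "integrable M (\<lambda>\<omega>. \<tau> (f k) (Z \<omega>))")
    case True
    have "expectation (\<lambda>\<omega>. \<tau> (f k) (Z \<omega>)) \<noteq> 0"
      using pos by (subst integral_nonneg_eq_0_iff_AE[OF True]) (auto simp: less_imp_le less_imp_neq[symmetric] AE_False)
    then show ?thesis using split[of "{k}"] mean by simp
  next
    case False
    have "indep_var borel (\<lambda>\<omega>. \<tau> (f k) (Z \<omega>)) borel (\<lambda>\<omega>. \<eta> \<omega> $ f k)"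
      using indep_var_sym[OF indep[of "{k}"]] by simp
    moreover have "integrable M (\<lambda>\<omega>. \<tau> (f k) (Z \<omega>) * \<eta> \<omega> $ f k)"
      by (rule integrable_cong_AE_imp[OF int]) (use prod_eq[of "{k}"] in \<open>auto simp: eq_commute\<close>)
    ultimately have "AE \<omega> in M. \<eta> \<omega> $ f k = 0"
      using False by (rule indep_var_integrable_factor)
    then show ?thesis by (rule integral_eq_zero_AE)
  qed
  moreover have "expectation (\<lambda>\<omega>. \<Prod>i\<in>B. \<eta> \<omega> $ f i)
      = expectation (\<lambda>\<omega>. \<eta> \<omega> $ f k) * expectation (\<lambda>\<omega>. \<Prod>i\<in>B - {k}. \<eta> \<omega> $ f i)"
  proof -
    \<comment> \<open>The coordinate \<open>f k\<close> is independent of the tuple of all others,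
      and by \<open>once\<close> the remaining product uses only those.\<close>
    let ?C = "- {f k}"
    have ne: "f i \<noteq> f k" if "i \<in> B - {k}" for i
      using once that by auto
    have "indep_var (PiM {f k} (\<lambda>_. borel)) (\<lambda>\<omega>. restrict (\<lambda>i. \<eta> \<omega> $ i) {f k})
        (PiM ?C (\<lambda>_. borel)) (\<lambda>\<omega>. restrict (\<lambda>i. \<eta> \<omega> $ i) ?C)"
      by (rule indep_var_restrict[OF ind\<eta>]) auto
    then have "indep_var borel ((\<lambda>x. x (f k)) \<circ> (\<lambda>\<omega>. restrict (\<lambda>i. \<eta> \<omega> $ i) {f k}))
        borel ((\<lambda>x. \<Prod>i\<in>B-{k}. x (f i)) \<circ> (\<lambda>\<omega>. restrict (\<lambda>i. \<eta> \<omega> $ i) ?C))"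
      by (rule indep_var_compose) (use ne in \<open>auto intro!: borel_measurable_prod measurable_component_singleton\<close>)
    moreover have "((\<lambda>x. \<Prod>i\<in>B-{k}. x (f i)) \<circ> (\<lambda>\<omega>. restrict (\<lambda>i. \<eta> \<omega> $ i) ?C))
        = (\<lambda>\<omega>. \<Prod>i\<in>B - {k}. \<eta> \<omega> $ f i)"
      unfolding comp_def by (intro ext prod.cong) (simp_all add: ne)
    ultimately have "indep_var borel (\<lambda>\<omega>. \<eta> \<omega> $ f k) borel (\<lambda>\<omega>. \<Prod>i\<in>B - {k}. \<eta> \<omega> $ f i)"
      by (simp add: comp_def)
    from indep_var_expectation_mult[OF this] show ?thesis
      using B by (simp add: prod.remove)
  qed
  ultimately show ?thesis
    using split[of B] by simp
qed

text \<open>The factors other than \<open>k\<close> are measurable with respect to the conditioning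
  sigma-algebra, so \<open>\<epsilon> $ f k\<close> may be replaced by its conditional expectation
  0. A non-integrable product has integral 0 by default.\<close>

lemma (in prob_space) mean_independent_joint_moment_0:
  fixes \<epsilon> :: "'a \<Rightarrow> real^'d"
  assumes model: "mean_independent_components M \<epsilon>"
    and [measurable]: "\<epsilon> \<in> borel_measurable M"
    and B: "finite B" "k \<in> B" and once: "\<And>i. i \<in> B \<Longrightarrow> f i = f k \<Longrightarrow> i = k"
  shows "expectation (\<lambda>\<omega>. \<Prod>i\<in>B. \<epsilon> \<omega> $ f i) = 0"
proof (cases "integrable M (\<lambda>\<omega>. \<Prod>i\<in>B. \<epsilon> \<omega> $ f i)")
  case True
  let ?C = "- {f k}"
  let ?F = "sigma_algebra_without M \<epsilon> (f k)"
  let ?R = "\<lambda>\<omega>. \<lambda>j\<in>?C. \<epsilon> \<omega> $ j"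
  have ne: "f i \<noteq> f k" if "i \<in> B - {k}" for i
    using once that by auto
  have R: "?R \<in> measurable M (PiM ?C (\<lambda>_. borel))"
    by measurable
  have "subalgebra M ?F"
    unfolding subalgebra_def sigma_algebra_without_def
    using sets_image_in_sets[OF refl R] by simp
  then interpret finite_measure_subalgebra M ?F
    by unfold_locales
  have RF: "?R \<in> measurable ?F (PiM ?C (\<lambda>_. borel))"
    unfolding sigma_algebra_without_def
    by (rule measurable_vimage_algebra1) (auto simp: space_PiM)
  \<comment> \<open>Measurability goes through \<open>?R\<close>, which generates \<open>?F\<close>;
    by \<open>once\<close> no remaining factor reads the omitted coordinate.\<close>
  have "(\<lambda>\<omega>. \<Prod>i\<in>B - {k}. ?R \<omega> (f i)) \<in> borel_measurable ?F"
    using ne by (intro borel_measurable_prod measurable_compose[OF RF measurable_component_singleton]) auto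
  also have "(\<lambda>\<omega>. \<Prod>i\<in>B - {k}. ?R \<omega> (f i)) = (\<lambda>\<omega>. \<Prod>i\<in>B - {k}. \<epsilon> \<omega> $ f i)"
    by (intro ext prod.cong) (simp_all add: ne)
  finally have meas: "(\<lambda>\<omega>. \<Prod>i\<in>B - {k}. \<epsilon> \<omega> $ f i) \<in> borel_measurable ?F" .
  have prod: "(\<Prod>i\<in>B. \<epsilon> \<omega> $ f i) = (\<Prod>i\<in>B - {k}. \<epsilon> \<omega> $ f i) * \<epsilon> \<omega> $ f k" for \<omega>
    using B by (simp add: prod.remove mult.commute)
  have "expectation (\<lambda>\<omega>. (\<Prod>i\<in>B - {k}. \<epsilon> \<omega> $ f i) * real_cond_exp M ?F (\<lambda>\<omega>. \<epsilon> \<omega> $ f k) \<omega>)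
      = expectation (\<lambda>\<omega>. (\<Prod>i\<in>B - {k}. \<epsilon> \<omega> $ f i) * \<epsilon> \<omega> $ f k)"
    by (rule real_cond_exp_intg(2)) (use True meas in \<open>auto simp: prod\<close>)
  moreover have "AE \<omega> in M. real_cond_exp M ?F (\<lambda>\<omega>. \<epsilon> \<omega> $ f k) \<omega> = 0"
    using model by (simp add: mean_independent_components_def)
  then have "expectation (\<lambda>\<omega>. (\<Prod>i\<in>B - {k}. \<epsilon> \<omega> $ f i) * real_cond_exp M ?F (\<lambda>\<omega>. \<epsilon> \<omega> $ f k) \<omega>) = 0"
    by (intro integral_eq_zero_AE) auto
  ultimately show ?thesis
    by (simp add: prod)
qed (rule not_integrable_integral_eq)

text \<open>A change of signs preserves Lebesgue measure and the unit ball, and it commutes with the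
  radial projection \<open>sgn\<close>.\<close>

lemma distr_uniform_sphere_reflection:
  fixes s :: "'d::finite \<Rightarrow> real"
  assumes s: "\<And>i. \<bar>s i\<bar> = 1"
  shows "distr uniform_sphere borel (\<lambda>x. \<chi> i. s i * x $ i) = uniform_sphere"
proof -
  define T where "T x = (\<chi> i. s i * x $ i)" for x :: "real^'d"
  have [measurable]: "T \<in> borel_measurable borel"
    unfolding T_def by (intro borel_measurable_continuous_onI continuous_intros)
  have sq: "s i * s i = 1" for i
    using s[of i] by (metis abs_mult_self_eq mult_1)
  have inv: "T (T x) = x" for x
    by (simp add: T_def vec_eq_iff mult.assoc[symmetric] sq)
  have norm: "norm (T x) = norm x" for x
    by (simp add: T_def norm_vec_def abs_mult s)
  have sgn: "T (sgn x) = sgn (T x)" for x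
    by (simp add: sgn_div_norm norm) (simp add: T_def vec_eq_iff)
  have lborel: "distr lborel borel T = (lborel :: (real^'d) measure)"
  proof -
    \<comment> \<open>The affine change of variables for \<open>lborel\<close> scales along
      \<open>Basis\<close> vectors, so the signs are moved from coordinates to basis vectors; the
      sum extracts \<open>s i\<close> from \<open>axis i 1\<close>.\<close>
    define c where "c j = (\<Sum>i\<in>UNIV. s i * j $ i)" for j :: "real^'d"
    have c: "c (axis i 1) = s i" for i
      by (simp add: c_def axis_def if_distrib cong: if_cong)
    have abs_c: "\<bar>c j\<bar> = 1" if "j \<in> Basis" for j
      using that s by (auto simp: Basis_vec_def c)
    have T_eq: "T x = 0 + (\<Sum>j\<in>Basis. (c j * (x \<bullet> j)) *\<^sub>R j)" for x
    proof (rule euclidean_eqI)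
      fix b :: "real^'d" assume b: "b \<in> Basis"
      then obtain i where i: "b = axis i 1" by (auto simp: Basis_vec_def)
      have "(\<Sum>j\<in>Basis. (c j * (x \<bullet> j)) *\<^sub>R j) \<bullet> b = c b * (x \<bullet> b)"
        using b by (simp add: inner_sum_left inner_Basis if_distrib cong: if_cong)
      then show "T x \<bullet> b = (0 + (\<Sum>j\<in>Basis. (c j * (x \<bullet> j)) *\<^sub>R j)) \<bullet> b"
        by (simp add: i c inner_axis T_def)
    qed
    \<comment> \<open>The density is the Jacobian factor, a product of absolute values of signs,
      hence 1.\<close>
    have "lborel = density (distr lborel borel T) (\<lambda>_. (\<Prod>j\<in>Basis. \<bar>c j\<bar>))"
      unfolding T_eq by (rule lborel_affine_euclidean) (use abs_c in fastforce)
    also have "(\<Prod>j\<in>Basis. \<bar>c j\<bar>) = 1"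
      by (simp add: abs_c)
    finally show ?thesis by (simp add: density_1)
  qed
  have ball: "T -` S \<inter> ball 0 1 = T -` (S \<inter> ball 0 1)" for S
    by (auto simp: norm)
  have emeasure_T: "emeasure lborel (T -` S) = emeasure lborel S" if "S \<in> sets borel" for S
    using emeasure_distr[of T lborel borel S] that by (simp add: lborel)
  have T_vimage: "T -` S \<in> sets borel" if "S \<in> sets borel" for S
    using measurable_sets[of T borel borel S] that by simp
  have unif: "distr (uniform_measure lborel (ball 0 1)) borel T = uniform_measure lborel (ball 0 1)"
    by (rule measure_eqI) (auto simp: emeasure_distr ball emeasure_T T_vimage Int_commute[of "ball 0 1"]
      simp del: vimage_Int)
  have "distr uniform_sphere borel T = distr (distr (uniform_measure lborel (ball 0 1)) borel T) borel sgn"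
    unfolding uniform_sphere_def by (subst (1 2) distr_distr) (auto simp: comp_def sgn)
  then show ?thesis
    unfolding unif T_def[abs_def, symmetric] by (simp add: uniform_sphere_def T_def[abs_def])
qed

text \<open>Flipping coordinate \<open>j\<close> preserves the measure and negates the monomial, so
  the integral equals its own negative.\<close>

lemma uniform_sphere_joint_moment_0:
  fixes f :: "'b \<Rightarrow> 'd::finite"
  assumes B: "finite B" and odd: "odd (card {i \<in> B. f i = j})"
  shows "(\<integral>x. (\<Prod>i\<in>B. x $ f i) \<partial>uniform_sphere) = 0"
proof -
  define s :: "'d \<Rightarrow> real" where "s i = (if i = j then -1 else 1)" for i
  have [measurable_cong, simp]: "sets uniform_sphere = sets borel"
    by (simp add: uniform_sphere_def)
  have [measurable]: "(\<lambda>x :: real^'d. \<chi> i. s i * x $ i) \<in> borel_measurable borel"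
    by (intro borel_measurable_continuous_onI continuous_intros)
  have sign: "(\<Prod>i\<in>B. s (f i)) = -1"
    using B odd by (simp add: s_def prod.If_cases Int_def)
  have "(\<integral>x. (\<Prod>i\<in>B. x $ f i) \<partial>uniform_sphere)
      = (\<integral>x. (\<Prod>i\<in>B. x $ f i) \<partial>distr uniform_sphere borel (\<lambda>x. \<chi> i. s i * x $ i))"
    by (subst distr_uniform_sphere_reflection) (auto simp: s_def)
  also have "\<dots> = (\<integral>x. - (\<Prod>i\<in>B. x $ f i) \<partial>uniform_sphere)"
    by (subst integral_distr) (auto simp: prod.distrib sign)
  finally show ?thesis by simp
qed

text \<open>Independence factors the moment, and the factor in \<open>U\<close> vanishes by the
  symmetry of the sphere. The product rule also covers non-integrable products of components of
  \<open>\<tau>\<close>.\<close>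

lemma (in prob_space) spherical_joint_moment_0:
  fixes \<epsilon> U \<tau> :: "'a \<Rightarrow> real^'d"
  assumes model: "spherical_model M \<tau> U \<epsilon>"
    and [measurable]: "\<epsilon> \<in> borel_measurable M"
    and B: "finite B" and odd: "odd (card {i \<in> B. f i = j})"
  shows "expectation (\<lambda>\<omega>. \<Prod>i\<in>B. \<epsilon> \<omega> $ f i) = 0"
proof -
  have distr: "distr M borel U = uniform_sphere" and ind: "independent_vectors M \<tau> U"
    and eq: "AE \<omega> in M. \<epsilon> \<omega> = \<tau> \<omega> * U \<omega>"
    using model by (auto simp: spherical_model_def)
  have [measurable]: "\<tau> \<in> borel_measurable M" "U \<in> borel_measurable M"
    using ind by (auto simp: independent_vectors_def)
  have "indep_var borel (\<lambda>\<omega>. \<Prod>i\<in>B. \<tau> \<omega> $ f i) borel (\<lambda>\<omega>. \<Prod>i\<in>B. U \<omega> $ f i)"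
    by (rule independent_vectors_indep_var[OF ind]) measurable
  then have "expectation (\<lambda>\<omega>. (\<Prod>i\<in>B. \<tau> \<omega> $ f i) * (\<Prod>i\<in>B. U \<omega> $ f i))
      = expectation (\<lambda>\<omega>. \<Prod>i\<in>B. \<tau> \<omega> $ f i) * expectation (\<lambda>\<omega>. \<Prod>i\<in>B. U \<omega> $ f i)"
    by (rule indep_var_expectation_mult)
  also have "expectation (\<lambda>\<omega>. \<Prod>i\<in>B. U \<omega> $ f i) = (\<integral>x. (\<Prod>i\<in>B. x $ f i) \<partial>distr M borel U)"
    by (subst integral_distr) auto
  also have "\<dots> = 0"
    unfolding distr by (rule uniform_sphere_joint_moment_0[OF B odd])
  finally have "expectation (\<lambda>\<omega>. (\<Prod>i\<in>B. \<tau> \<omega> $ f i) * (\<Prod>i\<in>B. U \<omega> $ f i)) = 0" by simp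
  moreover have "expectation (\<lambda>\<omega>. \<Prod>i\<in>B. \<epsilon> \<omega> $ f i)
      = expectation (\<lambda>\<omega>. (\<Prod>i\<in>B. \<tau> \<omega> $ f i) * (\<Prod>i\<in>B. U \<omega> $ f i))"
    by (rule integral_cong_AE) (use eq in \<open>auto simp: prod.distrib\<close>)
  ultimately show ?thesis by simp
qed

subsection \<open>Moment and cumulant tensors as multilinear forms\<close>

text \<open>One shape for both choices of \<open>h\<close>, with weights \<open>c\<close>. The slots
  take arbitrary random variables, so that coordinates can be replaced by inner products with
  vectors.\<close>

definition partition_form ::
    "(nat set set \<Rightarrow> real) \<Rightarrow> 'a measure \<Rightarrow> nat \<Rightarrow> (nat \<Rightarrow> 'a \<Rightarrow> real) \<Rightarrow> real" where
  "partition_form c M r V =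
     (\<Sum>\<pi> | partition_on {..<r} \<pi>. c \<pi> * (\<Prod>B\<in>\<pi>. \<integral>\<omega>. (\<Prod>k\<in>B. V k \<omega>) \<partial>M))"

text \<open>For moments all weight sits on the one-block partition, whose block is nonempty because
  \<open>r > 0\<close>. The same \<open>c\<close> serves all vectors and index lists, which allows
  comparing the tensors of \<open>X\<close> and \<open>Q *v X\<close>.\<close>

lemma partition_form_moment_or_cumulant:
  fixes h :: "nat \<Rightarrow> ('a \<Rightarrow> real^'d) \<Rightarrow> 'd tensor"
  assumes h: "h = moment_tensor M \<or> h = cumulant_tensor M" and r: "r > 0"
  obtains c where "\<And>X is. h r X is = partition_form c M r (\<lambda>k \<omega>. X \<omega> $ (is ! k))"
proof -
  have fin: "finite {\<pi>. partition_on {..<r} \<pi>}"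
    by (rule finitely_many_partition_on) simp
  have part: "partition_on {..<r} {{..<r}}"
    using r by (intro partition_on_space) auto
  have moment: "moment_tensor M r X is
      = partition_form (\<lambda>\<pi>. of_bool (\<pi> = {{..<r}})) M r (\<lambda>k \<omega>. X \<omega> $ (is ! k))"
    for X :: "'a \<Rightarrow> real^'d" and "is"
    using fin part by (simp add: moment_tensor_def partition_form_def sum.remove)
  have cumulant: "cumulant_tensor M r X is
      = partition_form (\<lambda>\<pi>. (-1) ^ (card \<pi> - 1) * fact (card \<pi> - 1)) M r (\<lambda>k \<omega>. X \<omega> $ (is ! k))"
    for X :: "'a \<Rightarrow> real^'d" and "is"
    by (simp add: cumulant_tensor_def partition_form_def)
  from h show ?thesis
  proof
    assume "h = moment_tensor M"
    then show ?thesis using moment by (intro that) simp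
  next
    assume "h = cumulant_tensor M"
    then show ?thesis using cumulant by (intro that) simp
  qed
qed

lemma partition_form_cong:
  assumes "\<And>k \<omega>. k < r \<Longrightarrow> V k \<omega> = W k \<omega>"
  shows "partition_form c M r V = partition_form c M r W"
proof -
  have "(\<Prod>k\<in>B. V k \<omega>) = (\<Prod>k\<in>B. W k \<omega>)" if "partition_on {..<r} \<pi>" "B \<in> \<pi>" for \<pi> B \<omega>
    using that assms by (intro prod.cong) (auto dest: partition_onD1)
  then show ?thesis
    unfolding partition_form_def by (intro sum.cong arg_cong2[where f="(*)"] prod.cong refl) auto
qed

text \<open>An odd number of marked indices cannot be spread over blocks that each contain an even number
  of them.\<close>

lemma partition_form_eq_0:
  assumes odd: "odd (card ({..<r} \<inter> J))"
    and zero: "\<And>B. B \<subseteq> {..<r} \<Longrightarrow> odd (card (B \<inter> J)) \<Longrightarrow> (\<integral>\<omega>. (\<Prod>k\<in>B. V k \<omega>) \<partial>M) = 0"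
  shows "partition_form c M r V = 0"
  unfolding partition_form_def
proof (rule sum.neutral, clarify)
  fix \<pi> assume \<pi>: "partition_on {..<r} \<pi>"
  then have fin: "finite \<pi>" and un: "{..<r} = \<Union>\<pi>"
    using finite_elements by (auto dest: partition_onD1)
  have sub: "B \<subseteq> {..<r}" if "B \<in> \<pi>" for B
    using that un by auto
  then have finB: "finite B" if "B \<in> \<pi>" for B
    using that finite_subset by blast
  have disj: "A \<inter> B = {}" if "A \<in> \<pi>" "B \<in> \<pi>" "A \<noteq> B" for A B
    using partition_onD2[OF \<pi>] that by (simp add: disjoint_def)
  have "{..<r} \<inter> J = (\<Union>B\<in>\<pi>. B \<inter> J)"
    using un by auto
  also have "card \<dots> = (\<Sum>B\<in>\<pi>. card (B \<inter> J))"
    using \<pi> fin finB by (intro card_UN_disjoint) (blast dest: disj)+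
  finally obtain B where B: "B \<in> \<pi>" "odd (card (B \<inter> J))"
    using odd by (metis dvd_sum)
  have "(\<integral>\<omega>. (\<Prod>k\<in>B. V k \<omega>) \<partial>M) = 0"
    by (rule zero[OF sub[OF B(1)] B(2)])
  then show "c \<pi> * (\<Prod>B\<in>\<pi>. \<integral>\<omega>. (\<Prod>k\<in>B. V k \<omega>) \<partial>M) = 0"
    using fin B(1) by (metis mult_zero_right prod_zero)
qed

text \<open>Every slot lies in exactly one block of a partition, so each \<open>a k\<close> is
  pulled out exactly once.\<close>

lemma partition_form_scale:
  "partition_form c M r (\<lambda>k \<omega>. a k * V k \<omega>) = (\<Prod>k<r. a k) * partition_form c M r V"
proof -
  have "(\<Prod>B\<in>\<pi>. \<integral>\<omega>. (\<Prod>k\<in>B. a k * V k \<omega>) \<partial>M)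
      = (\<Prod>k<r. a k) * (\<Prod>B\<in>\<pi>. \<integral>\<omega>. (\<Prod>k\<in>B. V k \<omega>) \<partial>M)" if \<pi>: "partition_on {..<r} \<pi>" for \<pi>
  proof -
    have un: "{..<r} = \<Union>\<pi>" using \<pi> by (rule partition_onD1)
    then have "\<forall>B\<in>\<pi>. finite B" by (metis Union_upper finite_lessThan finite_subset)
    then have "(\<Prod>k<r. a k) = (\<Prod>B\<in>\<pi>. \<Prod>k\<in>B. a k)"
      unfolding un using partition_onD2[OF \<pi>]
      by (subst prod.Union_disjoint) (simp_all add: disjoint_def)
    then show ?thesis by (simp add: prod.distrib)
  qed
  then show ?thesis
    unfolding partition_form_def sum_distrib_left by (intro sum.cong) (auto simp: mult.left_commute)
qed

section \<open>Reflectional invariance from vanishing joint moments\<close>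

lemma card_index_eq_count_list:
  assumes "length xs = r"
  shows "card {k. k < r \<and> xs ! k = i} = count_list xs i"
  using assms by (simp add: count_list_eq_length_filter length_filter_conv_card eq_commute)

text \<open>The marked index \<open>j\<close> may depend on the list: the spherical model accepts
  any index of odd multiplicity, the other two need one of multiplicity 1. Moments over all subsets
  \<open>B\<close> are needed because a cumulant involves blocks.\<close>

lemma reflectionally_invariant_if_joint_moments_0:
  fixes h :: "nat \<Rightarrow> ('a \<Rightarrow> real^'d) \<Rightarrow> 'd tensor" and X :: "'a \<Rightarrow> real^'d"
  assumes h: "h = moment_tensor M \<or> h = cumulant_tensor M" and r: "r > 0"
    and zero: "\<And>is. length is = r \<Longrightarrow> \<exists>i. odd (count_list is i) \<Longrightarrow>
       \<exists>j. odd (count_list is j) \<and> (\<forall>B\<subseteq>{..<r}. odd (card {k\<in>B. is ! k = j}) \<longrightarrow>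
           (\<integral>\<omega>. (\<Prod>k\<in>B. X \<omega> $ (is ! k)) \<partial>M) = 0)"
  shows "reflectionally_invariant r (h r X)"
  unfolding reflectionally_invariant_def
proof (intro allI impI)
  fix "is" :: "'d list" assume "is": "length is = r" "\<not> (\<forall>i. even (count_list is i))"
  from partition_form_moment_or_cumulant[OF h r]
  obtain c where c: "h r X is = partition_form c M r (\<lambda>k \<omega>. X \<omega> $ (is ! k))" by metis
  obtain j where j: "odd (count_list is j)"
    "\<And>B. B \<subseteq> {..<r} \<Longrightarrow> odd (card {k\<in>B. is ! k = j}) \<Longrightarrow> (\<integral>\<omega>. (\<Prod>k\<in>B. X \<omega> $ (is ! k)) \<partial>M) = 0"
    using zero[of "is"] "is" by auto
  have "partition_form c M r (\<lambda>k \<omega>. X \<omega> $ (is ! k)) = 0"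
  proof (rule partition_form_eq_0[where J = "{k. is ! k = j}"])
    show "odd (card ({..<r} \<inter> {k. is ! k = j}))"
      using j(1) card_index_eq_count_list[of "is" r j] "is" by (simp add: Int_def)
  qed (use j(2) in \<open>simp add: Int_def\<close>)
  then show "h r X is = 0" using c by simp
qed

text \<open>An odd count in four entries is 1 or 3; if it is 3, the remaining entry occurs
  once.\<close>

lemma count_list_eq_1_if_odd:
  assumes "length xs = 4" "odd (count_list xs i)"
  obtains j where "count_list xs j = 1"
proof -
  obtain a b c d where "xs = [a, b, c, d]"
    using assms(1) by (auto simp: length_Suc_conv eval_nat_numeral)
  then have "count_list xs a = 1 \<or> count_list xs b = 1 \<or> count_list xs c = 1 \<or> count_list xs d = 1"
    using assms(2) by (auto split: if_splits)
  then show ?thesis using that by blast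
qed

text \<open>Some index occupies a single slot \<open>k\<close>. A block meeting that index an odd
  number of times must contain \<open>k\<close>, and within the block no other slot carries the
  index.\<close>

lemma reflectionally_invariant_4_if_joint_moments_0:
  fixes h :: "nat \<Rightarrow> ('a \<Rightarrow> real^'d) \<Rightarrow> 'd tensor" and X :: "'a \<Rightarrow> real^'d"
  assumes h: "h = moment_tensor M \<or> h = cumulant_tensor M"
    and zero: "\<And>f k B. finite B \<Longrightarrow> k \<in> B \<Longrightarrow> (\<And>i. i \<in> B \<Longrightarrow> f i = f k \<Longrightarrow> i = (k::nat)) \<Longrightarrow>
       (\<integral>\<omega>. (\<Prod>i\<in>B. X \<omega> $ f i) \<partial>M) = 0"
  shows "reflectionally_invariant 4 (h 4 X)"
proof (rule reflectionally_invariant_if_joint_moments_0[OF h])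
  fix "is" :: "'d list" assume len: "length is = 4" and "\<exists>i. odd (count_list is i)"
  then obtain j where j: "count_list is j = 1"
    using count_list_eq_1_if_odd by metis
  then have "card {k. k < 4 \<and> is ! k = j} = 1"
    using card_index_eq_count_list[OF len] by metis
  then obtain k where k: "{k. k < 4 \<and> is ! k = j} = {k}"
    by (rule card_1_singletonE)
  have "(\<integral>\<omega>. (\<Prod>i\<in>B. X \<omega> $ (is ! i)) \<partial>M) = 0"
    if B: "B \<subseteq> {..<4}" and odd: "odd (card {k\<in>B. is ! k = j})" for B
  proof (rule zero[where k = k])
    show "finite B" using B finite_subset by blast
    have sub: "{k\<in>B. is ! k = j} \<subseteq> {k}" using k B by auto
    have "{k\<in>B. is ! k = j} \<noteq> {}" using odd by (metis card.empty even_zero)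
    then show "k \<in> B" using sub by auto
    show "i = k" if "i \<in> B" "is ! i = is ! k" for i
    proof -
      have "is ! k = j" using k by blast
      then have "i \<in> {k. k < 4 \<and> is ! k = j}" using that B by auto
      then show ?thesis unfolding k by simp
    qed
  qed
  then show "\<exists>j. odd (count_list is j) \<and> (\<forall>B\<subseteq>{..<4}. odd (card {k\<in>B. is ! k = j}) \<longrightarrow>
           (\<integral>\<omega>. (\<Prod>k\<in>B. X \<omega> $ (is ! k)) \<partial>M) = 0)"
    using j by (intro exI[of _ j]) simp
qed simp

section \<open>Integrability and multilinearity\<close>

lemma (in prob_space) integrable_norm_power_if_finite_moments:
  fixes X :: "'a \<Rightarrow> real^'d"
  assumes [measurable]: "X \<in> borel_measurable M" and "finite_moments M r X"
  shows "integrable M (\<lambda>\<omega>. norm (X \<omega>) ^ r)"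
proof (rule Bochner_Integration.integrable_bound)
  let ?d = "real CARD('d)"
  show "integrable M (\<lambda>\<omega>. \<Sum>i\<in>UNIV. ?d ^ r * \<bar>X \<omega> $ i\<bar> ^ r)"
    using assms(2) by (simp add: finite_moments_def)
  have "norm x ^ r \<le> (\<Sum>i\<in>UNIV. ?d ^ r * \<bar>x $ i\<bar> ^ r)" for x :: "real^'d"
  proof -
    have "Max (range (\<lambda>i. \<bar>x $ i\<bar>)) \<in> range (\<lambda>i. \<bar>x $ i\<bar>)"
      by (intro Max_in) auto
    \<comment> \<open>A coordinate of largest absolute value: the norm is at most \<open>?d\<close>
      times it, and its power is one of the summands of the bound.\<close>
    then obtain m where m: "Max (range (\<lambda>i. \<bar>x $ i\<bar>)) = \<bar>x $ m\<bar>"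
      by (rule rangeE)
    have "norm x \<le> (\<Sum>i\<in>UNIV. \<bar>x $ i\<bar>)"
      by (rule norm_le_l1_cart)
    also have "\<dots> \<le> (\<Sum>i\<in>(UNIV :: 'd set). \<bar>x $ m\<bar>)"
      by (intro sum_mono) (auto simp: m[symmetric])
    finally have "norm x ^ r \<le> (?d * \<bar>x $ m\<bar>) ^ r"
      by (intro power_mono) auto
    also have "\<dots> \<le> (\<Sum>i\<in>UNIV. ?d ^ r * \<bar>x $ i\<bar> ^ r)"
      unfolding power_mult_distrib by (intro member_le_sum) auto
    finally show ?thesis .
  qed
  then show "AE \<omega> in M. norm (norm (X \<omega>) ^ r) \<le> norm (\<Sum>i\<in>UNIV. ?d ^ r * \<bar>X \<omega> $ i\<bar> ^ r)"
    by (intro AE_I2) (simp add: abs_le_iff order_trans[OF _ abs_ge_self])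
qed measurable

text \<open>Blocks can have any size up to \<open>r\<close>. Cauchy-Schwarz bounds the product by a
  constant times \<open>norm (X \<omega>) ^ card B\<close>, and t^n \<le> 1 + t^r for n \<le> r and
  t \<ge> 0.\<close>

lemma (in prob_space) integrable_prod_inner:
  fixes X :: "'a \<Rightarrow> real^'d"
  assumes [measurable]: "X \<in> borel_measurable M" and "finite_moments M r X" and B: "B \<subseteq> {..<r}"
  shows "integrable M (\<lambda>\<omega>. \<Prod>k\<in>B. v k \<bullet> X \<omega>)"
proof (rule Bochner_Integration.integrable_bound)
  have finB: "finite B" using B finite_subset by blast
  have card: "card B \<le> r" using card_mono[OF _ B] by simp
  let ?C = "\<Prod>k\<in>B. norm (v k)"
  show "integrable M (\<lambda>\<omega>. ?C * (1 + norm (X \<omega>) ^ r))"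
    using integrable_norm_power_if_finite_moments[OF assms(1,2)] by simp
  have "\<bar>\<Prod>k\<in>B. v k \<bullet> x\<bar> \<le> ?C * (1 + norm x ^ r)" for x
  proof -
    have "\<bar>\<Prod>k\<in>B. v k \<bullet> x\<bar> \<le> (\<Prod>k\<in>B. norm (v k) * norm x)"
      unfolding abs_prod by (intro prod_mono) (auto simp: Cauchy_Schwarz_ineq2)
    also have "\<dots> = ?C * norm x ^ card B"
      by (simp add: prod.distrib)
    also have "\<dots> \<le> ?C * (1 + norm x ^ r)"
    proof (intro mult_left_mono prod_nonneg ballI norm_ge_zero)
      show "norm x ^ card B \<le> 1 + norm x ^ r"
        using power_increasing[OF card, of "norm x"] power_le_one[of "norm x" "card B"]
        by (cases "norm x \<ge> 1") (auto simp: add_increasing2)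
    qed
    finally show ?thesis .
  qed
  then show "AE \<omega> in M. norm (\<Prod>k\<in>B. v k \<bullet> X \<omega>) \<le> norm (?C * (1 + norm (X \<omega>) ^ r))"
    by (intro AE_I2) (simp add: order_trans[OF _ abs_ge_self])
qed measurable

text \<open>The slot \<open>m\<close> lies in exactly one block of each partition. That block's
  integral is linear in \<open>x\<close>, and the other blocks contribute constants.\<close>

lemma (in prob_space) linear_partition_form:
  fixes X :: "'a \<Rightarrow> real^'d"
  assumes "X \<in> borel_measurable M" "finite_moments M r X" and m: "m < r"
  shows "linear (\<lambda>x. partition_form c M r (\<lambda>k \<omega>. (v(m := x)) k \<bullet> X \<omega>))"
  unfolding partition_form_def
proof (rule linear_compose_sum, clarify)
  fix \<pi> assume \<pi>: "partition_on {..<r} \<pi>"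
  then have fin: "finite \<pi>" and un: "{..<r} = \<Union>\<pi>"
    using finite_elements by (auto dest: partition_onD1)
  then obtain B where B: "B \<in> \<pi>" "m \<in> B"
    using m by auto
  then have sub: "B \<subseteq> {..<r}" using un by auto
  then have finB: "finite B" using finite_subset by blast
  let ?I = "\<lambda>B x. \<integral>\<omega>. (\<Prod>k\<in>B. (v(m := x)) k \<bullet> X \<omega>) \<partial>M"
  \<comment> \<open>The vector 0 is a mere placeholder for a slot that these blocks do not
    contain.\<close>
  have other: "?I B' x = ?I B' 0" if "B' \<in> \<pi> - {B}" for B' x
  proof -
    have "m \<notin> B'" using that B partition_onD2[OF \<pi>] by (auto simp only: disjoint_def)
    then show ?thesis by (intro Bochner_Integration.integral_cong prod.cong) auto
  qed
  have prod: "(\<Prod>k\<in>B. (v(m := x)) k \<bullet> X \<omega>) = (x \<bullet> X \<omega>) * (\<Prod>k\<in>B - {m}. v k \<bullet> X \<omega>)" for x \<omega>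
    using finB B by (subst prod.remove[of _ m]) (auto intro!: prod.cong)
  have int: "integrable M (\<lambda>\<omega>. (x \<bullet> X \<omega>) * (\<Prod>k\<in>B - {m}. v k \<bullet> X \<omega>))" for x
    using integrable_prod_inner[OF assms(1,2) sub, of "v(m := x)"] by (simp only: prod)
  have lin: "linear (?I B)"
    unfolding prod
    by (rule linearI) (use int in \<open>simp_all add: inner_add_left distrib_right mult.assoc\<close>)
  have "(\<lambda>x. c \<pi> * (\<Prod>B\<in>\<pi>. ?I B x)) = (\<lambda>x. (c \<pi> * (\<Prod>B'\<in>\<pi> - {B}. ?I B' 0)) *\<^sub>R ?I B x)"
  proof
    fix x
    have "(\<Prod>B'\<in>\<pi> - {B}. ?I B' x) = (\<Prod>B'\<in>\<pi> - {B}. ?I B' 0)"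
      by (rule prod.cong[OF refl other])
    then show "c \<pi> * (\<Prod>B\<in>\<pi>. ?I B x) = (c \<pi> * (\<Prod>B'\<in>\<pi> - {B}. ?I B' 0)) *\<^sub>R ?I B x"
      unfolding prod.remove[OF fin B(1)] by simp
  qed
  then show "linear (\<lambda>x. c \<pi> * (\<Prod>B\<in>\<pi>. ?I B x))"
    using linear_compose_scale_right[OF lin] by metis
qed

text \<open>The list split \<open>ps @ x # ws\<close> singles out a slot, which suits inductions
  that peel off arguments from the front.\<close>

definition multilinear_form :: "nat \<Rightarrow> ('v::real_vector list \<Rightarrow> real) \<Rightarrow> bool" where
  "multilinear_form r F \<longleftrightarrow>
     (\<forall>ps ws. Suc (length ps + length ws) = r \<longrightarrow> linear (\<lambda>x. F (ps @ x # ws)))"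

lemma (in prob_space) multilinear_partition_form:
  fixes X :: "'a \<Rightarrow> real^'d"
  assumes "X \<in> borel_measurable M" "finite_moments M r X"
  shows "multilinear_form r (\<lambda>vs. partition_form c M r (\<lambda>k \<omega>. (vs ! k) \<bullet> X \<omega>))"
  unfolding multilinear_form_def
proof (intro allI impI)
  fix ps ws :: "(real^'d) list" assume "Suc (length ps + length ws) = r"
  then have m: "length ps < r" by simp
  have nth: "(ps @ x # ws) ! k = ((\<lambda>k. (ps @ 0 # ws) ! k)(length ps := x)) k" for x k
    by (auto simp: nth_append nth_Cons')
  have "(\<lambda>x. partition_form c M r (\<lambda>k \<omega>. (ps @ x # ws) ! k \<bullet> X \<omega>))
      = (\<lambda>x. partition_form c M r (\<lambda>k \<omega>. ((\<lambda>k. (ps @ 0 # ws) ! k)(length ps := x)) k \<bullet> X \<omega>))"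
    by (intro ext partition_form_cong arg_cong2[where f = inner] nth refl)
  then show "linear (\<lambda>x. partition_form c M r (\<lambda>k \<omega>. (ps @ x # ws) ! k \<bullet> X \<omega>))"
    using linear_partition_form[OF assms m] by simp
qed

section \<open>Contractions over an orthonormal basis\<close>

text \<open>The trace of a bilinear form does not depend on the orthonormal basis.\<close>

lemma sum_orthogonal_matrix_rows:
  fixes b :: "real^'d \<Rightarrow> real^'d \<Rightarrow> real" and Q :: "real^'d^'d"
  assumes Q: "orthogonal_matrix Q"
    and lin1: "\<And>y. linear (\<lambda>x. b x y)" and lin2: "\<And>x. linear (b x)"
  shows "(\<Sum>i\<in>UNIV. b (row i Q) (row i Q)) = (\<Sum>i\<in>UNIV. b (axis i 1) (axis i 1))"
proof -
  have row: "row i Q = (\<Sum>a\<in>UNIV. (Q $ i $ a) *\<^sub>R axis a 1)" for i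
    by (simp add: vec_eq_iff row_def axis_def if_distrib cong: if_cong)
  have orth: "(\<Sum>i\<in>UNIV. Q $ i $ a * Q $ i $ a') = (if a = a' then 1 else 0)" for a a'
  proof -
    have "transpose Q ** Q = mat 1" using Q by (simp add: orthogonal_matrix)
    then have "(transpose Q ** Q) $ a $ a' = mat 1 $ a $ a'" by simp
    then show ?thesis by (simp add: matrix_matrix_mult_def transpose_def mat_def)
  qed
  have "b (row i Q) (row i Q)
      = (\<Sum>a\<in>UNIV. \<Sum>a'\<in>UNIV. (Q $ i $ a * Q $ i $ a') * b (axis a 1) (axis a' 1))" for i
  proof -
    have "b (row i Q) (row i Q) = (\<Sum>a\<in>UNIV. Q $ i $ a * b (axis a 1) (row i Q))"
      by (subst (1) row) (simp add: linear_sum[OF lin1] linear_cmul[OF lin1])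
    also have "\<dots> = (\<Sum>a\<in>UNIV. \<Sum>a'\<in>UNIV. (Q $ i $ a * Q $ i $ a') * b (axis a 1) (axis a' 1))"
      by (subst row) (simp add: linear_sum[OF lin2] linear_cmul[OF lin2] sum_distrib_left mult.assoc)
    finally show ?thesis .
  qed
  then have "(\<Sum>i\<in>UNIV. b (row i Q) (row i Q))
      = (\<Sum>i\<in>UNIV. \<Sum>a\<in>UNIV. \<Sum>a'\<in>UNIV. (Q $ i $ a * Q $ i $ a') * b (axis a 1) (axis a' 1))"
    by simp
  \<comment> \<open>The sum over rows is moved innermost, where orthonormality of the columns
    (\<open>orth\<close>) leaves only the terms with \<open>a = a'\<close>.\<close>
  also have "\<dots> = (\<Sum>a\<in>UNIV. \<Sum>i\<in>UNIV. \<Sum>a'\<in>UNIV. (Q $ i $ a * Q $ i $ a') * b (axis a 1) (axis a' 1))"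
    by (rule sum.swap)
  also have "\<dots> = (\<Sum>a\<in>UNIV. \<Sum>a'\<in>UNIV. \<Sum>i\<in>UNIV. (Q $ i $ a * Q $ i $ a') * b (axis a 1) (axis a' 1))"
    by (intro sum.cong refl sum.swap)
  also have "\<dots> = (\<Sum>i\<in>UNIV. b (axis i 1) (axis i 1))"
    unfolding sum_distrib_right[symmetric] orth by (simp add: if_distrib if_distribR cong: if_cong)
  finally show ?thesis .
qed

text \<open>The index pattern of \<open>diagonal_contraction\<close>: \<open>q\<close> is the
  identity on index lists, and it sends an index to a standard basis vector or to a row of
  \<open>Q\<close> in arguments of a form.\<close>

definition doubled :: "('i \<Rightarrow> 'v) \<Rightarrow> 'i list \<Rightarrow> 'v list" where
  "doubled q is = concat (map (\<lambda>i. [q i, q i]) is)"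

lemma doubled_simps [simp]:
  "doubled q [] = []" "doubled q (i # is) = q i # q i # doubled q is"
  "length (doubled q is) = 2 * length is"
  by (induction "is") (auto simp: doubled_def)

lemma map_doubled: "map g (doubled q is) = doubled (\<lambda>i. g (q i)) is"
  by (induction "is") auto

lemma even_count_list_doubled: "even (count_list (doubled (\<lambda>i. i) is) j)"
  by (induction "is") auto

lemma finite_lists_length [simp]: "finite {xs :: 'i::finite list. length xs = n}"
  using finite_lists_length_eq[of "UNIV :: 'i set" n] by simp

lemma sum_lists_length_Suc:
  fixes g :: "'i::finite list \<Rightarrow> real"
  shows "(\<Sum>is | length is = Suc n. g is) = (\<Sum>i\<in>UNIV. \<Sum>is | length is = n. g (i # is))"
proof -
  have "{is :: 'i list. length is = Suc n} = (\<lambda>(i, is). i # is) ` (UNIV \<times> {is. length is = n})"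
    by (auto simp: length_Suc_conv image_iff)
  then show ?thesis
    by (simp add: sum.reindex inj_on_def sum.cartesian_product case_prod_unfold)
qed

text \<open>Each doubled pair contributes the trace of a bilinear form, so the pairs can be
  exchanged one at a time.\<close>

lemma contraction_orthogonal_matrix:
  fixes F :: "(real^'d) list \<Rightarrow> real" and Q :: "real^'d^'d"
  assumes F: "multilinear_form r F" and Q: "orthogonal_matrix Q"
    and "length ps + 2 * l + length ws = r"
  shows "(\<Sum>is | length is = l. F (ps @ doubled (\<lambda>i. row i Q) is @ ws))
       = (\<Sum>is | length is = l. F (ps @ doubled (\<lambda>i. axis i 1) is @ ws))"
  using assms(3)
proof (induction l arbitrary: ps)
  case 0
  then show ?case by simp
next
  case (Suc l)
  let ?q = "\<lambda>i. row i Q" and ?e = "\<lambda>i. axis i 1 :: real^'d"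
  \<comment> \<open>With the first pair absorbed into the prefix \<open>ps\<close>, the induction
    hypothesis exchanges all later pairs; \<open>trace\<close> then exchanges the first.\<close>
  have IH: "(\<Sum>is | length is = l. F (ps @ ?q i # ?q i # doubled ?q is @ ws))
       = (\<Sum>is | length is = l. F (ps @ ?q i # ?q i # doubled ?e is @ ws))" for i
    using Suc.IH[of "ps @ [?q i, ?q i]"] Suc.prems by simp
  have trace: "(\<Sum>i\<in>UNIV. F (ps @ ?q i # ?q i # doubled ?e is @ ws))
      = (\<Sum>i\<in>UNIV. F (ps @ ?e i # ?e i # doubled ?e is @ ws))" if "length is = l" for "is"
  proof (rule sum_orthogonal_matrix_rows[OF Q, where b = "\<lambda>x y. F (ps @ x # y # doubled ?e is @ ws)"])
    show "linear (\<lambda>x. F (ps @ x # y # doubled ?e is @ ws))" for y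
      using F that Suc.prems unfolding multilinear_form_def
      by (elim allE[of _ ps] allE[of _ "y # doubled ?e is @ ws"]) simp
    show "linear (\<lambda>y. F (ps @ x # y # doubled ?e is @ ws))" for x
      using F that Suc.prems unfolding multilinear_form_def
      by (elim allE[of _ "ps @ [x]"] allE[of _ "doubled ?e is @ ws"]) simp
  qed
  have "(\<Sum>is | length is = Suc l. F (ps @ doubled ?q is @ ws))
      = (\<Sum>i\<in>UNIV. \<Sum>is | length is = l. F (ps @ ?q i # ?q i # doubled ?e is @ ws))"
    by (simp add: sum_lists_length_Suc IH)
  also have "\<dots> = (\<Sum>is | length is = l. \<Sum>i\<in>UNIV. F (ps @ ?q i # ?q i # doubled ?e is @ ws))"
    by (rule sum.swap)
  also have "\<dots> = (\<Sum>is | length is = l. \<Sum>i\<in>UNIV. F (ps @ ?e i # ?e i # doubled ?e is @ ws))"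
    by (intro sum.cong refl trace) simp
  also have "\<dots> = (\<Sum>i\<in>UNIV. \<Sum>is | length is = l. F (ps @ ?e i # ?e i # doubled ?e is @ ws))"
    by (rule sum.swap)
  also have "\<dots> = (\<Sum>is | length is = Suc l. F (ps @ doubled ?e is @ ws))"
    by (simp add: sum_lists_length_Suc)
  finally show ?case .
qed

subsection \<open>Identifiability\<close>

lemma signed_permutation_matrices_eq:
  "(signed_permutation_matrices :: (real^'d^'d) set)
    = {Q. \<exists>s p. (\<forall>i. s i = 1 \<or> s i = -1) \<and> bij p \<and> Q = (\<chi> i j. if j = p i then s i else 0)}"
proof -
  have mult: "(\<chi> i j. if i = j then s i else 0) ** (\<chi> i j. if j = p i then 1 else 0)
      = (\<chi> i j. if j = p i then s i else (0::real))" for s and p :: "'d \<Rightarrow> 'd"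
  proof -
    have "(\<Sum>k\<in>UNIV. (if i = k then s i else 0) * (if j = p k then 1 else 0))
        = (\<Sum>k\<in>UNIV. if k = i then (if j = p i then s i else 0) else 0)" for i j
      by (intro sum.cong) auto
    then show ?thesis
      by (simp add: vec_eq_iff matrix_matrix_mult_def)
  qed
  show ?thesis
    unfolding signed_permutation_matrices_def sign_matrices_def permutation_matrices_def
  proof (intro equalityI subsetI)
    fix Q :: "real^'d^'d"
    assume "Q \<in> {Q. \<exists>s p. (\<forall>i. s i = 1 \<or> s i = -1) \<and> bij p \<and> Q = (\<chi> i j. if j = p i then s i else 0)}"
    then obtain s p where sp: "\<forall>i. s i = 1 \<or> s i = -1" "bij p" "Q = (\<chi> i j. if j = p i then s i else 0)"
      by blast
    then have "Q = (\<chi> i j. if i = j then s i else 0) ** (\<chi> i j. if j = p i then 1 else 0)"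
      by (simp only: mult)
    with sp(1,2) show "Q \<in> {D ** P | D P. D \<in> {D. \<exists>s. (\<forall>i. s i = 1 \<or> s i = -1) \<and> D = (\<chi> i j. if i = j then s i else 0)} \<and>
        P \<in> {P. \<exists>p. bij p \<and> P = (\<chi> i j. if j = p i then 1 else 0)}}"
      unfolding mem_Collect_eq by blast
  qed (clarify, simp only: mult mem_Collect_eq, blast)
qed

text \<open>A nonzero entry \<open>Q $ i $ a\<close> forces \<open>D i = d a\<close>, so by
  injectivity of \<open>d\<close> each row has at most one nonzero entry. Orthonormal rows make this
  entry a sign and put it in a different column for each row.\<close>

lemma orthogonal_matrix_diagonalising:
  fixes Q :: "real^'d^'d"
  assumes Q: "orthogonal_matrix Q" and d: "inj d"
    and eigen: "\<And>i a. D i * Q $ i $ a = Q $ i $ a * d a"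
  shows "Q \<in> signed_permutation_matrices"
proof -
  have rows: "(\<Sum>a\<in>UNIV. Q $ i $ a * Q $ j $ a) = (if i = j then 1 else 0)" for i j
  proof -
    have "(Q ** transpose Q) $ i $ j = mat 1 $ i $ j" using Q by (simp add: orthogonal_matrix_def)
    then show ?thesis by (simp add: matrix_matrix_mult_def transpose_def mat_def)
  qed
  have "\<exists>a. Q $ i $ a \<noteq> 0" for i
    using rows[of i i] by (metis (no_types, lifting) mult_zero_left sum.neutral zero_neq_one)
  \<comment> \<open>\<open>p i\<close> is the column of a nonzero entry of row \<open>i\<close>; one
    exists because the row has norm 1.\<close>
  then obtain p where p: "\<And>i. Q $ i $ p i \<noteq> 0" by metis
  have zero: "Q $ i $ a = 0" if "a \<noteq> p i" for i a
  proof (rule ccontr)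
    assume "Q $ i $ a \<noteq> 0"
    then have "d a = D i" using eigen[of i a] by simp
    also have "\<dots> = d (p i)" using eigen[of i "p i"] p[of i] by simp
    finally show False using d that by (simp add: inj_eq)
  qed
  have prod: "(\<Sum>a\<in>UNIV. Q $ i $ a * Q $ j $ a) = Q $ i $ p i * Q $ j $ p i" for i j
  proof -
    have "(\<Sum>a\<in>UNIV. Q $ i $ a * Q $ j $ a) = (\<Sum>a\<in>{p i}. Q $ i $ a * Q $ j $ a)"
      by (rule sum.mono_neutral_right) (auto simp: zero)
    then show ?thesis by simp
  qed
  have "inj p"
  proof (rule injI, rule ccontr)
    fix i j assume "p i = p j" "i \<noteq> j"
    then show False using prod[of i j] rows[of i j] p[of i] p[of j] by simp
  qed
  then have "bij p" by (simp add: bij_def finite_UNIV_inj_surj)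
  moreover have "Q $ i $ p i = 1 \<or> Q $ i $ p i = -1" for i
    using prod[of i i] rows[of i i] by (simp add: square_eq_1_iff)
  moreover have "Q = (\<chi> i j. if j = p i then Q $ i $ p i else 0)"
    by (simp add: vec_eq_iff zero)
  ultimately show ?thesis
    unfolding signed_permutation_matrices_eq mem_Collect_eq
    by (intro exI[of _ "\<lambda>i. Q $ i $ p i"] exI[of _ p]) simp
qed

lemma signed_permutation_matrix_orthogonal:
  assumes "Q \<in> signed_permutation_matrices"
  shows "orthogonal_matrix Q"
proof -
  obtain s p where s: "\<forall>i. s i = 1 \<or> s i = -1" and p: "bij p"
    and Q: "Q = (\<chi> i j. if j = p i then s i else 0)"
    using assms unfolding signed_permutation_matrices_eq by blast
  have sq: "s i * s i = 1" for i using s by (metis mult_1 mult_minus1 minus_minus)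
  have "Q ** transpose Q = mat 1"
  proof -
    have "(\<Sum>k\<in>UNIV. (if k = p i then s i else 0) * (if k = p j then s j else 0)) = (if i = j then 1 else 0)"
      for i j
    proof -
      have "(\<Sum>k\<in>UNIV. (if k = p i then s i else 0) * (if k = p j then s j else 0))
          = (\<Sum>k\<in>UNIV. if k = p i then (if p i = p j then s i * s j else 0) else 0)"
        by (intro sum.cong) auto
      also have "\<dots> = (if i = j then 1 else 0)"
        using p by (simp add: bij_is_inj inj_eq sq)
      finally show ?thesis .
    qed
    then show ?thesis
      by (simp add: Q vec_eq_iff matrix_matrix_mult_def transpose_def mat_def)
  qed
  then show ?thesis
    by (simp add: orthogonal_matrix_def matrix_left_right_inverse)
qed

section \<open>Covariance of standardized vectors\<close>

lemma (in prob_space) integrable_mult_if_square_integrable: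
  fixes f g :: "'a \<Rightarrow> real"
  assumes [measurable]: "f \<in> borel_measurable M" "g \<in> borel_measurable M"
    and "integrable M (\<lambda>x. f x ^ 2)" "integrable M (\<lambda>x. g x ^ 2)"
  shows "integrable M (\<lambda>x. f x * g x)"
proof (rule Bochner_Integration.integrable_bound)
  show "integrable M (\<lambda>x. f x ^ 2 + g x ^ 2)" using assms by simp
  have "\<bar>a * b\<bar> \<le> \<bar>a ^ 2 + b ^ 2\<bar>" for a b :: real
  proof -
    have "\<bar>a * b\<bar> \<le> 2 * \<bar>a\<bar> * \<bar>b\<bar>" by (simp add: abs_mult)
    also have "\<dots> \<le> \<bar>a\<bar> ^ 2 + \<bar>b\<bar> ^ 2" by (rule sum_squares_bound)
    finally show ?thesis by simp
  qed
  then show "AE x in M. norm (f x * g x) \<le> norm (f x ^ 2 + g x ^ 2)" by simp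
qed measurable

locale standardized = prob_space M for M :: "'a measure" +
  fixes X :: "'a \<Rightarrow> real^'d"
  assumes measurable_X [measurable]: "X \<in> borel_measurable M"
    and mean_0: "expectation (\<lambda>\<omega>. X \<omega> $ i) = 0"
    and covariance: "covariance_matrix M X = mat 1"
begin

lemma expectation_mult: "expectation (\<lambda>\<omega>. X \<omega> $ i * X \<omega> $ j) = (if i = j then 1 else 0)"
proof -
  have "covariance_matrix M X $ i $ j = mat 1 $ i $ j" by (simp add: covariance)
  then show ?thesis by (simp add: covariance_matrix_def mean_0 mat_def)
qed

text \<open>A non-integrable square would have Bochner integral 0 instead of 1.\<close>

lemma square_integrable: "integrable M (\<lambda>\<omega>. (X \<omega> $ i) ^ 2)"
  using expectation_mult[of i i] not_integrable_integral_eq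
  by (fastforce simp: power2_eq_square)

lemma integrable_mult: "integrable M (\<lambda>\<omega>. X \<omega> $ i * X \<omega> $ j)"
  by (rule integrable_mult_if_square_integrable) (simp_all add: square_integrable)

text \<open>Multiply by the constant 1, which is square integrable on a probability space. Model (1)
  takes its integrability of first moments from here.\<close>

lemma integrable_component: "integrable M (\<lambda>\<omega>. X \<omega> $ i)"
  using integrable_mult_if_square_integrable[of "\<lambda>_. 1" "\<lambda>\<omega>. X \<omega> $ i"] by (simp add: square_integrable)

text \<open>Turns the condition of unit covariance after applying \<open>Q\<close> into
  orthogonality of \<open>Q\<close>.\<close>

lemma covariance_matrix_mult: "covariance_matrix M (\<lambda>\<omega>. Q *v X \<omega>) = Q ** transpose Q"
  for Q :: "real^'d^'n"
proof -
  have mean: "expectation (\<lambda>\<omega>. (Q *v X \<omega>) $ i) = 0" for i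
    by (simp add: matrix_vector_mult_def mean_0 integrable_component)
  have "expectation (\<lambda>\<omega>. (Q *v X \<omega>) $ i * (Q *v X \<omega>) $ j) = (Q ** transpose Q) $ i $ j" for i j
  proof -
    have "expectation (\<lambda>\<omega>. (Q *v X \<omega>) $ i * (Q *v X \<omega>) $ j)
        = expectation (\<lambda>\<omega>. \<Sum>a\<in>UNIV. \<Sum>b\<in>UNIV. (Q $ i $ a * Q $ j $ b) * (X \<omega> $ a * X \<omega> $ b))"
      by (simp add: matrix_vector_mult_def sum_product ac_simps)
    also have "\<dots> = (\<Sum>a\<in>UNIV. \<Sum>b\<in>UNIV. (Q $ i $ a * Q $ j $ b) * (if a = b then 1 else 0))"
      by (simp add: integrable_mult expectation_mult)
    also have "\<dots> = (Q ** transpose Q) $ i $ j"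
      by (simp add: matrix_matrix_mult_def transpose_def if_distrib cong: if_cong)
    finally show ?thesis .
  qed
  then show ?thesis
    by (simp add: covariance_matrix_def mean vec_eq_iff)
qed

end

section \<open>Orthogonal transformations and reflectional invariance\<close>

text \<open>Coordinate \<open>i\<close> of \<open>Q *v X\<close> is \<open>s i\<close> times
  coordinate \<open>p i\<close> of \<open>X\<close>. The tensor is thus relabelled and multiplied by
  signs, and a bijective relabelling preserves multiplicities.\<close>

lemma reflectionally_invariant_signed_permutation:
  fixes h :: "nat \<Rightarrow> ('a \<Rightarrow> real^'d) \<Rightarrow> 'd tensor" and X :: "'a \<Rightarrow> real^'d"
  assumes h: "h = moment_tensor M \<or> h = cumulant_tensor M" and r: "r > 0"
    and Q: "Q \<in> signed_permutation_matrices" and inv: "reflectionally_invariant r (h r X)"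
  shows "reflectionally_invariant r (h r (\<lambda>\<omega>. Q *v X \<omega>))"
  unfolding reflectionally_invariant_def
proof (intro allI impI)
  fix "is" :: "'d list" assume len: "length is = r" and "\<not> (\<forall>i. even (count_list is i))"
  then obtain i where odd: "odd (count_list is i)" by blast
  obtain s p where p: "bij p" and Q_eq: "Q = (\<chi> i j. if j = p i then s i else 0)"
    using Q unfolding signed_permutation_matrices_eq by blast
  have Q_X: "(Q *v x) $ i = s i * x $ p i" for x i
    by (simp add: Q_eq matrix_vector_mult_def if_distrib if_distribR cong: if_cong)
  obtain c where c: "\<And>X is. h r X is = partition_form c M r (\<lambda>k \<omega>. X \<omega> $ (is ! k))"
    using partition_form_moment_or_cumulant[OF h r] by blast
  have "count_list (map p is) (p i) = count_list is i"
    by (rule count_list_map_conv[OF bij_is_inj[OF p]])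
  then have "h r X (map p is) = 0"
    using inv len odd by (metis length_map reflectionally_invariant_def)
  moreover have "h r (\<lambda>\<omega>. Q *v X \<omega>) is = (\<Prod>k<r. s (is ! k)) * h r X (map p is)"
    unfolding c Q_X partition_form_scale
    by (intro arg_cong2[where f = "(*)"] partition_form_cong refl) (simp add: len)
  ultimately show "h r (\<lambda>\<omega>. Q *v X \<omega>) is = 0" by simp
qed

lemma (in prob_space) signed_permutation_if_reflectionally_invariant:
  fixes h :: "nat \<Rightarrow> ('a \<Rightarrow> real^'d) \<Rightarrow> 'd tensor" and X :: "'a \<Rightarrow> real^'d"
  assumes h: "h = moment_tensor M \<or> h = cumulant_tensor M"
    and X: "X \<in> borel_measurable M" "finite_moments M r X"
    and r: "r = 2 * l + 2"
    and Q: "orthogonal_matrix Q"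
    and inv: "reflectionally_invariant r (h r X)" "reflectionally_invariant r (h r (\<lambda>\<omega>. Q *v X \<omega>))"
    and distinct: "\<And>j k. j \<noteq> k \<Longrightarrow> diagonal_contraction l (h r X) j \<noteq> diagonal_contraction l (h r X) k"
  shows "Q \<in> signed_permutation_matrices"
proof -
  obtain c where c: "\<And>X is. h r X is = partition_form c M r (\<lambda>k \<omega>. X \<omega> $ (is ! k))"
    using partition_form_moment_or_cumulant[OF h, of r] r by auto
  \<comment> \<open>On standard basis vectors \<open>F\<close> gives the tensor of \<open>X\<close>,
    on rows of \<open>Q\<close> that of \<open>Q *v X\<close>.\<close>
  define F where "F vs = partition_form c M r (\<lambda>k \<omega>. (vs ! k) \<bullet> X \<omega>)" for vs
  have F: "multilinear_form r F"
    unfolding F_def by (rule multilinear_partition_form[OF X])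
  let ?q = "\<lambda>i. row i Q" and ?e = "\<lambda>i. axis i 1 :: real^'d"
  have h_X: "h r X js = F (map ?e js)" if "length js = r" for js
    unfolding c F_def using that by (intro partition_form_cong) (simp add: inner_axis')
  have h_QX: "h r (\<lambda>\<omega>. Q *v X \<omega>) js = F (map ?q js)" if "length js = r" for js
    unfolding c F_def using that
    by (intro partition_form_cong) (simp add: matrix_vector_mul_component row_def)
  \<comment> \<open>The doubled part contributes an even count of \<open>j\<close>, and the tail
    exactly one more since \<open>j \<noteq> k\<close>. So all off-diagonal entries under the
    contraction vanish.\<close>
  have odd: "odd (count_list (doubled (\<lambda>i. i) is @ [j, k]) j)" if "j \<noteq> k" for j k :: 'd and "is"
    using that by (simp add: even_count_list_doubled)
  \<comment> \<open>The contracted bilinear form: \<open>l\<close> pairs are summed out and the last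
    two of the \<open>2 * l + 2\<close> slots stay free.\<close>
  define b where "b x y = (\<Sum>is | length is = l. F (doubled ?e is @ [x, y]))" for x y
  have lin1: "linear (\<lambda>x. b x y)" for y
    unfolding b_def
  proof (rule linear_compose_sum, clarify)
    fix "is" :: "'d list" assume "l = length is"
    then show "linear (\<lambda>x. F (doubled ?e is @ [x, y]))"
      using F r unfolding multilinear_form_def
      by (elim allE[of _ "doubled ?e is"] allE[of _ "[y]"]) simp
  qed
  have lin2: "linear (b x)" for x
    unfolding b_def
  proof (rule linear_compose_sum, clarify)
    fix "is" :: "'d list" assume "l = length is"
    then show "linear (\<lambda>y. F (doubled ?e is @ [x, y]))"
      using F r unfolding multilinear_form_def
      by (elim allE[of _ "doubled ?e is @ [x]"] allE[of _ "[]"]) simp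
  qed
  have diag: "b (?e j) (?e j) = diagonal_contraction l (h r X) j" for j
    unfolding b_def diagonal_contraction_def
    unfolding doubled_def[where q = "\<lambda>i. i", symmetric]
    by (intro sum.cong refl) (subst h_X, simp_all add: map_doubled r)
  have b_e: "b (?e j) (?e k) = 0" if "j \<noteq> k" for j k
    unfolding b_def
  proof (rule sum.neutral, clarify)
    fix "is" :: "'d list" assume l: "l = length is"
    have "h r X (doubled (\<lambda>i. i) is @ [j, k]) = 0"
      by (rule inv(1)[unfolded reflectionally_invariant_def, rule_format])
          (simp add: l r, use odd[OF that] in blast)
    then show "F (doubled ?e is @ [?e j, ?e k]) = 0"
        using h_X[of "doubled (\<lambda>i. i) is @ [j, k]"] l r by (simp add: map_doubled)
  qed
  \<comment> \<open>Basis independence rewrites the contraction over the rows of \<open>Q\<close>,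
    which turns its summands into entries of the tensor of \<open>Q *v X\<close>.\<close>
  have b_q: "b (?q j) (?q k) = 0" if "j \<noteq> k" for j k
  proof -
    have "b (?q j) (?q k) = (\<Sum>is | length is = l. F (doubled ?q is @ [?q j, ?q k]))"
      using contraction_orthogonal_matrix[OF F Q, of "[]" l "[?q j, ?q k]"] r
      by (simp add: b_def)
    also have "\<dots> = 0"
    proof (rule sum.neutral, clarify)
      fix "is" :: "'d list" assume l: "l = length is"
      have "h r (\<lambda>\<omega>. Q *v X \<omega>) (doubled (\<lambda>i. i) is @ [j, k]) = 0"
        by (rule inv(2)[unfolded reflectionally_invariant_def, rule_format])
          (simp add: l r, use odd[OF that] in blast)
      then show "F (doubled ?q is @ [?q j, ?q k]) = 0"
        using h_QX[of "doubled (\<lambda>i. i) is @ [j, k]"] l r by (simp add: map_doubled)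
    qed
    finally show ?thesis .
  qed
  have row: "?q i = (\<Sum>a\<in>UNIV. (Q $ i $ a) *\<^sub>R ?e a)" for i
    by (simp add: vec_eq_iff row_def axis_def if_distrib cong: if_cong)
  have axis: "?e a = (\<Sum>i\<in>UNIV. (Q $ i $ a) *\<^sub>R ?q i)" for a
  proof -
    have "(transpose Q ** Q) $ a $ j = mat 1 $ a $ j" for j
      using Q by (simp add: orthogonal_matrix)
    then show ?thesis
      by (simp add: vec_eq_iff row_def axis_def matrix_matrix_mult_def transpose_def mat_def eq_commute)
  qed
  \<comment> \<open>Both sides equal \<open>b (?q i) (?e a)\<close>: expand \<open>?e a\<close> in
    the rows and use \<open>b_q\<close>, or expand \<open>?q i\<close> in the standard basis and use
    \<open>b_e\<close>.\<close>
  have eigen: "b (?q i) (?q i) * Q $ i $ a = Q $ i $ a * diagonal_contraction l (h r X) a" for i a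
  proof -
    have "b (?q i) (?e a) = (\<Sum>j\<in>UNIV. Q $ j $ a * b (?q i) (?q j))"
      by (subst axis) (simp add: linear_sum[OF lin2] linear_cmul[OF lin2])
    also have "\<dots> = (\<Sum>j\<in>{i}. Q $ j $ a * b (?q i) (?q j))"
      by (rule sum.mono_neutral_right) (auto simp: b_q)
    finally have 1: "b (?q i) (?e a) = Q $ i $ a * b (?q i) (?q i)" by simp
    have "b (?q i) (?e a) = (\<Sum>j\<in>UNIV. Q $ i $ j * b (?e j) (?e a))"
      by (subst row) (simp add: linear_sum[OF lin1] linear_cmul[OF lin1])
    also have "\<dots> = (\<Sum>j\<in>{a}. Q $ i $ j * b (?e j) (?e a))"
      by (rule sum.mono_neutral_right) (auto simp: b_e)
    finally show ?thesis using 1 diag[of a] by simp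
  qed
  have "inj (diagonal_contraction l (h r X))"
    using distinct by (meson injI)
  then show ?thesis
    by (rule orthogonal_matrix_diagonalising[OF Q _ eigen])
qed

theorem corollary5p15:
  fixes M :: "'a measure"
    and Y \<epsilon> \<eta> \<tau> U :: "'a \<Rightarrow> real^'d"
    and A :: "real^'d^'d"
    and K :: "real^'m^'d"
    and Z :: "'a \<Rightarrow> real^'m"
    and \<phi> :: "real \<Rightarrow> real"
    and h :: "nat \<Rightarrow> ('a \<Rightarrow> real^'d) \<Rightarrow> 'd tensor"
  assumes "prob_space M"
    and "Y \<in> borel_measurable M"
    and "invertible A"
    and "\<epsilon> = (\<lambda>\<omega>. A *v Y \<omega>)"
    and "\<forall>i. (\<integral>\<omega>. \<epsilon> \<omega> $ i \<partial>M) = 0"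
    and "covariance_matrix M \<epsilon> = mat 1"
    and "h = moment_tensor M \<or> h = cumulant_tensor M"
  shows
    "(finite_moments M 4 \<epsilon> \<and> independent_components_model M \<phi> K Z \<eta> \<epsilon> \<longrightarrow>
        reflectionally_invariant 4 (h 4 \<epsilon>)) \<and>
     (\<forall>r. even r \<and> r \<ge> 4 \<and> finite_moments M r \<epsilon> \<and> spherical_model M \<tau> U \<epsilon> \<longrightarrow>
        reflectionally_invariant r (h r \<epsilon>)) \<and>
     (finite_moments M 4 \<epsilon> \<and> mean_independent_components M \<epsilon> \<longrightarrow>
        reflectionally_invariant 4 (h 4 \<epsilon>)) \<and>
     (\<forall>r. ((independent_components_model M \<phi> K Z \<eta> \<epsilon> \<and> r = 4) \<or>
           (spherical_model M \<tau> U \<epsilon> \<and> even r \<and> r \<ge> 4) \<or>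
           (mean_independent_components M \<epsilon> \<and> r = 4)) \<and>
          finite_moments M r \<epsilon> \<and>
          (\<forall>j k. j \<noteq> k \<longrightarrow>
             diagonal_contraction ((r - 2) div 2) (h r \<epsilon>) j \<noteq>
             diagonal_contraction ((r - 2) div 2) (h r \<epsilon>) k) \<longrightarrow>
        {B. invertible B \<and> covariance_matrix M (\<lambda>\<omega>. B *v Y \<omega>) = mat 1 \<and>
            reflectionally_invariant r (h r (\<lambda>\<omega>. B *v Y \<omega>))} =
        {Q ** A | Q. Q \<in> signed_permutation_matrices})"
proof -
  interpret prob_space M by fact
  note \<epsilon> = \<open>\<epsilon> = (\<lambda>\<omega>. A *v Y \<omega>)\<close> and h = \<open>h = moment_tensor M \<or> h = cumulant_tensor M\<close>
  have "(\<lambda>y. A *v y) \<in> borel_measurable borel"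
    by (intro borel_measurable_continuous_onI continuous_intros)
  then have meas [measurable]: "\<epsilon> \<in> borel_measurable M"
    unfolding \<epsilon> by (rule measurable_compose[OF \<open>Y \<in> borel_measurable M\<close>])
  interpret standardized M \<epsilon>
    by unfold_locales (use meas assms(5,6) in simp_all)
  have inv1: "reflectionally_invariant 4 (h 4 \<epsilon>)" if "independent_components_model M \<phi> K Z \<eta> \<epsilon>"
    by (rule reflectionally_invariant_4_if_joint_moments_0[OF h])
      (rule independent_components_joint_moment_0[OF that meas integrable_component mean_0])
  have inv2: "reflectionally_invariant r (h r \<epsilon>)" if "spherical_model M \<tau> U \<epsilon>" "r \<ge> 4" for r
  proof (rule reflectionally_invariant_if_joint_moments_0[OF h])
    show "r > 0" using that by simp
    fix "is" :: "'d list" assume "\<exists>i. odd (count_list is i)"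
    then obtain j where "odd (count_list is j)" by blast
    moreover have "(\<integral>\<omega>. (\<Prod>k\<in>B. \<epsilon> \<omega> $ (is ! k)) \<partial>M) = 0"
      if "B \<subseteq> {..<r}" "odd (card {k\<in>B. is ! k = j})" for B
      by (rule spherical_joint_moment_0[OF \<open>spherical_model M \<tau> U \<epsilon>\<close> meas finite_subset[OF that(1)] that(2)]) simp
    ultimately show "\<exists>j. odd (count_list is j) \<and> (\<forall>B\<subseteq>{..<r}. odd (card {k\<in>B. is ! k = j}) \<longrightarrow>
           (\<integral>\<omega>. (\<Prod>k\<in>B. \<epsilon> \<omega> $ (is ! k)) \<partial>M) = 0)"
      by blast
  qed
  have inv3: "reflectionally_invariant 4 (h 4 \<epsilon>)" if "mean_independent_components M \<epsilon>"
    by (rule reflectionally_invariant_4_if_joint_moments_0[OF h])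
      (rule mean_independent_joint_moment_0[OF that meas])
  \<comment> \<open>The models enter only through reflectional invariance of
    \<open>h r \<epsilon>\<close>, so one argument serves all three.\<close>
  have ident: "{B. invertible B \<and> covariance_matrix M (\<lambda>\<omega>. B *v Y \<omega>) = mat 1 \<and>
            reflectionally_invariant r (h r (\<lambda>\<omega>. B *v Y \<omega>))} =
        {Q ** A | Q. Q \<in> signed_permutation_matrices}" (is "?L = ?R")
    if inv: "reflectionally_invariant r (h r \<epsilon>)" and r: "even r" "r \<ge> 4" and mom: "finite_moments M r \<epsilon>"
      and distinct: "\<forall>j k. j \<noteq> k \<longrightarrow>
             diagonal_contraction ((r - 2) div 2) (h r \<epsilon>) j \<noteq>
             diagonal_contraction ((r - 2) div 2) (h r \<epsilon>) k" for r
  proof (intro equalityI subsetI)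
    fix B assume "B \<in> ?L"
    then have B: "covariance_matrix M (\<lambda>\<omega>. B *v Y \<omega>) = mat 1"
      "reflectionally_invariant r (h r (\<lambda>\<omega>. B *v Y \<omega>))" by auto
    obtain A' where A': "A' ** A = mat 1"
      using \<open>invertible A\<close> by (auto simp: invertible_def)
    \<comment> \<open>Since \<open>A'\<close> inverts \<open>A\<close>, this is the matrix that
      expresses \<open>B *v Y \<omega>\<close> through \<open>\<epsilon> \<omega>\<close>; unit
      covariance then makes it orthogonal.\<close>
    define Q where "Q = B ** A'"
    have QA: "Q ** A = B"
      by (simp add: Q_def matrix_mul_assoc[symmetric] A')
    have BY: "(\<lambda>\<omega>. B *v Y \<omega>) = (\<lambda>\<omega>. Q *v \<epsilon> \<omega>)"
      by (simp add: \<epsilon> matrix_vector_mul_assoc QA)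
    have "Q ** transpose Q = mat 1"
      using B(1) by (simp add: BY covariance_matrix_mult)
    then have "orthogonal_matrix Q"
      by (simp add: orthogonal_matrix_def matrix_left_right_inverse)
    \<comment> \<open>Here \<open>l\<close> is \<open>(r - 2) div 2\<close>; evenness of
      \<open>r\<close> and \<open>r \<ge> 4\<close> give \<open>r = 2 * l + 2\<close>.\<close>
    then have "Q \<in> signed_permutation_matrices"
      by (rule signed_permutation_if_reflectionally_invariant[OF h meas mom, rotated])
        (use inv B(2) distinct r in \<open>auto simp: BY\<close>)
    then show "B \<in> ?R" using QA by blast
  next
    fix B assume "B \<in> ?R"
    then obtain Q where Q: "Q \<in> signed_permutation_matrices" and B: "B = Q ** A" by blast
    have orth: "orthogonal_matrix Q" by (rule signed_permutation_matrix_orthogonal[OF Q])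
    have BY: "(\<lambda>\<omega>. B *v Y \<omega>) = (\<lambda>\<omega>. Q *v \<epsilon> \<omega>)"
      by (simp add: \<epsilon> matrix_vector_mul_assoc B)
    have "invertible Q" using orth by (auto simp: orthogonal_matrix_def invertible_def)
    then have "invertible B" unfolding B using \<open>invertible A\<close> by (rule invertible_mult)
    moreover have "covariance_matrix M (\<lambda>\<omega>. B *v Y \<omega>) = mat 1"
      using orth by (simp add: BY covariance_matrix_mult orthogonal_matrix_def)
    moreover have "reflectionally_invariant r (h r (\<lambda>\<omega>. B *v Y \<omega>))"
      unfolding BY using r by (intro reflectionally_invariant_signed_permutation[OF h _ Q inv]) simp
    ultimately show "B \<in> ?L" by simp
  qed
  show ?thesis
  proof (intro conjI allI impI)
    fix r assume *: "((independent_components_model M \<phi> K Z \<eta> \<epsilon> \<and> r = 4) \<or>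
           (spherical_model M \<tau> U \<epsilon> \<and> even r \<and> r \<ge> 4) \<or>
           (mean_independent_components M \<epsilon> \<and> r = 4)) \<and>
          finite_moments M r \<epsilon> \<and>
          (\<forall>j k. j \<noteq> k \<longrightarrow>
             diagonal_contraction ((r - 2) div 2) (h r \<epsilon>) j \<noteq>
             diagonal_contraction ((r - 2) div 2) (h r \<epsilon>) k)"
    then have "reflectionally_invariant r (h r \<epsilon>)" "even r" "r \<ge> 4"
      using inv1 inv2 inv3 by auto
    with * show "{B. invertible B \<and> covariance_matrix M (\<lambda>\<omega>. B *v Y \<omega>) = mat 1 \<and>
            reflectionally_invariant r (h r (\<lambda>\<omega>. B *v Y \<omega>))} =
        {Q ** A | Q. Q \<in> signed_permutation_matrices}"
      by (intro ident) blast+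
  qed (use inv1 inv2 inv3 in blast)+
qed

end
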